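(* For every $j\in\mathbb{R}$, the function $f(x)=x+\dfrac{x}{\log^j(x)}$ is not complementary-bounded.
   Context: All graphs are finite and simple. Here $\log^j(x)$ means $(\log x)^j$. The function $f$ is considered on the positive integers; at $x=1$, where the formula may be undefined because $\log 1=0$, $f(1)$ is read as an arbitrary fixed real number $\ge 1$. For a graph $G$, $\omega(G)$ and $\alpha(G)$ denote the maximum size of a clique and of a stable set of $G$; $\chi(G)$ and $\theta(G)$ denote the minimum number of stable sets, respectively of cliques, needed to cover the vertices of $G$. A graph $G$ is $\chi$-bounded (respectively $\theta$-bounded) by a function $f$ if $\chi(H)\le f(\omega(H))$ (respectively $\theta(H)\le f(\alpha(H))$) for every (nonempty) induced subgraph $H$ of $G$. A function $f$ is complementary-bounded if there exists a (real-valued) function $g$ such that every graph that is $\chi$-bounded by $f$ is $\theta$-bounded by $g$. *)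

theory Defs
  imports Complex_Main "Graph_Theory.Graph_Theory"
begin

text \<open>
  Finite simple graphs are the \<open>pair_graph\<close>s of \<open>Graph_Theory\<close>: finite, loop-free digraphs with a
  symmetric set of arcs, the arcs being pairs of vertices. An edge \<open>uv\<close> is thus represented by the
  two arcs \<open>(u, v)\<close> and \<open>(v, u)\<close>.
\<close>

definition clique :: "'a pair_pre_digraph \<Rightarrow> 'a set \<Rightarrow> bool" where
  "clique G K \<longleftrightarrow> K \<subseteq> pverts G \<and> (\<forall>u\<in>K. \<forall>v\<in>K. u \<noteq> v \<longrightarrow> (u, v) \<in> parcs G)"

definition stable_set :: "'a pair_pre_digraph \<Rightarrow> 'a set \<Rightarrow> bool" where
  "stable_set G S \<longleftrightarrow> S \<subseteq> pverts G \<and> (\<forall>u\<in>S. \<forall>v\<in>S. (u, v) \<notin> parcs G)"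

definition clique_number :: "'a pair_pre_digraph \<Rightarrow> nat" where
  "clique_number G = Max {card K |K. clique G K}"

definition stability_number :: "'a pair_pre_digraph \<Rightarrow> nat" where
  "stability_number G = Max {card S |S. stable_set G S}"

definition chromatic_number :: "'a pair_pre_digraph \<Rightarrow> nat" where
  "chromatic_number G = (LEAST k. \<exists>C. finite C \<and> card C = k \<and> (\<forall>S\<in>C. stable_set G S) \<and> \<Union>C = pverts G)"

definition clique_cover_number :: "'a pair_pre_digraph \<Rightarrow> nat" where
  "clique_cover_number G = (LEAST k. \<exists>C. finite C \<and> card C = k \<and> (\<forall>K\<in>C. clique G K) \<and> \<Union>C = pverts G)"

text \<open>
  Bounding functions are functions on the positive integers; their value at \<open>0\<close> is never used,
  because a nonempty graph has clique number and stability number at least \<open>1\<close>.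
\<close>

definition chi_bounded_by :: "(nat \<Rightarrow> real) \<Rightarrow> 'a pair_pre_digraph \<Rightarrow> bool" where
  "chi_bounded_by f G \<longleftrightarrow>
     (\<forall>H. induced_subgraph (with_proj H) (with_proj G) \<and> pverts H \<noteq> {} \<longrightarrow> 
        real (chromatic_number H) \<le> f (clique_number H))"

definition theta_bounded_by :: "(nat \<Rightarrow> real) \<Rightarrow> 'a pair_pre_digraph \<Rightarrow> bool" where
  "theta_bounded_by f G \<longleftrightarrow>
     (\<forall>H. induced_subgraph (with_proj H) (with_proj G) \<and> pverts H \<noteq> {} \<longrightarrow> 
        real (clique_cover_number H) \<le> f (stability_number H))"

text \<open>
  Every finite graph is isomorphic to one whose vertices are natural numbers, so quantifying over
  graphs on \<^typ>\<open>nat\<close> amounts to quantifying over all finite graphs.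
\<close>

definition complementary_bounded :: "(nat \<Rightarrow> real) \<Rightarrow> bool" where
  "complementary_bounded f \<longleftrightarrow>
     (\<exists>g :: nat \<Rightarrow> real. \<forall>G :: nat pair_pre_digraph.
        pair_graph G \<and> chi_bounded_by f G \<longrightarrow> theta_bounded_by g G)"

end

theory Submission
  imports Defs "HOL-Library.Z2" "HOL-Library.FuncSet" "HOL-Real_Asymp.Real_Asymp"
begin

text \<open>
  For given \<open>d\<close> and large \<open>r\<close>, consider the lattice points on the boundary of the cube \<open>[-r, r]\<close> to the
  power \<open>d\<close>, and call two of them nearly opposite if every coordinate of their sum has absolute value at
  most 1. This relation is a discrete Borsuk graph, and the graph \<open>G\<close> that refutes complementary
  boundedness is its complement. Three facts about the Borsuk graph are needed.

  Its chromatic number exceeds \<open>d\<close> (\<open>box_sphere_colouring_bound\<close>). This is the theorem of Lusternik and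
  Schnirelmann, proved here by Fan's parity argument: a proper colouring gives an antipodal labelling,
  and the number of simplices with alternating labels, modulo two, is the same on the spheres of all
  dimensions (\<open>hemisphere_chain\<close>). The chains that fill the hemispheres are traces of an explicit
  contraction.

  It contains no triangle (\<open>opposite_triangle_free\<close>), so \<open>G\<close> has stability number at most 2, while
  its clique cover number is larger than \<open>d\<close>. As \<open>d\<close> is arbitrary, \<open>G\<close> is not \<open>\<theta>\<close>-bounded by any fixed
  function.

  Every induced subgraph becomes bipartite after deleting at most the fraction \<open>d / r\<close> of its vertices
  (\<open>bipartite_remainder\<close>). Koenig's theorem shows that the vertices of a bipartite graph are covered by as
  many edges and single vertices as a largest stable set has elements. Passing to complements, the
  chromatic number of an induced subgraph of \<open>G\<close> with clique number \<open>a\<close> is at most \<open>a + 4 * d * a / r\<close>.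
  Since \<open>G\<close> has at most \<open>(2 * r + 1) ^ d\<close> vertices, the logarithm of \<open>a\<close> is of order at most \<open>d * ln r\<close>, and
  for large \<open>r\<close> the excess is below \<open>a / ln a powr j\<close>.
\<close>

section \<open>Chains modulo two\<close>

text \<open>
  Simplices are lists of vertices, with repetitions allowed, so that every map of vertices induces a
  chain map. A chain is a list of simplices and a cochain is a function into the two-element field;
  an identity between chains modulo two is stated by summing an arbitrary cochain over both of them.
  The empty list is a face of every one-vertex list, so the complex is the augmented one.

  The simplifier would turn sums of bits into conditional expressions; the arguments below only use
  that addition is an abelian group operation of exponent two.
\<close>

declare add_bit_eq_xor [simp del]

fun faces :: "'a list \<Rightarrow> 'a list list" where
  "faces [] = []"
| "faces (v # vs) = vs # map (Cons v) (faces vs)"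

definition coboundary :: "('a list \<Rightarrow> bit) \<Rightarrow> 'a list \<Rightarrow> bit" where
  "coboundary F \<sigma> = (\<Sum>\<tau>\<leftarrow>faces \<sigma>. F \<tau>)"

text \<open>
  The subdivision of the prism over a simplex whose bottom and top are its images under two maps.
\<close>

fun prism :: "('a \<Rightarrow> 'b) \<Rightarrow> ('a \<Rightarrow> 'b) \<Rightarrow> 'a list \<Rightarrow> 'b list list" where
  "prism f g [] = []"
| "prism f g (v # vs) = (f v # g v # map g vs) # map (Cons (f v)) (prism f g vs)"

lemma bit_double: "(b::bit) + b = 0" "b + (b + c) = c"
  by (cases b; cases c; simp)+

lemma coboundary_Nil [simp]: "coboundary F [] = 0"
  by (simp add: coboundary_def)

lemma coboundary_Cons: "coboundary F (v # vs) = F vs + coboundary (\<lambda>\<tau>. F (v # \<tau>)) vs"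
  by (simp add: coboundary_def o_def)

lemma coboundary_add: "coboundary (\<lambda>\<sigma>. F \<sigma> + G \<sigma>) \<tau> = coboundary F \<tau> + coboundary G \<tau>"
  by (simp add: coboundary_def sum_list_addf)

lemma coboundary_zero [simp]: "coboundary (\<lambda>_. 0) \<sigma> = 0"
  by (simp add: coboundary_def)

lemma faces_map: "faces (map f \<sigma>) = map (map f) (faces \<sigma>)"
  by (induction \<sigma>) auto

lemma coboundary_map: "coboundary F (map f \<sigma>) = coboundary (\<lambda>\<tau>. F (map f \<tau>)) \<sigma>"
  by (simp add: coboundary_def faces_map o_def)

text \<open>
  The prism operator is a chain homotopy between the chain maps of \<open>f\<close> and \<open>g\<close>. With the first vertex \<open>v\<close>
  split off, the prism over \<open>vs\<close>, and likewise the faces of \<open>map g vs\<close> prefixed with \<open>f v\<close> and \<open>g v\<close>, occur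
  once in the boundary of the prism and once in the prism over the boundary, and so cancel.
\<close>

lemma prism_homotopy:
  "(\<Sum>\<tau>\<leftarrow>prism f g \<sigma>. coboundary F \<tau>) + coboundary (\<lambda>\<tau>. \<Sum>\<rho>\<leftarrow>prism f g \<tau>. F \<rho>) \<sigma>
     = F (map f \<sigma>) + F (map g \<sigma>)"
proof (induction \<sigma> arbitrary: F)
  case Nil
  show ?case by (simp add: bit_double)
next
  case (Cons v vs)
  let ?F = "\<lambda>\<tau>. F (f v # \<tau>)"
  have 1: "(\<Sum>\<tau>\<leftarrow>prism f g (v # vs). coboundary F \<tau>) =
     F (map g (v # vs)) + (?F (map g vs) + coboundary (\<lambda>\<tau>. ?F (g v # \<tau>)) (map g vs))
     + ((\<Sum>\<tau>\<leftarrow>prism f g vs. F \<tau>) + (\<Sum>\<tau>\<leftarrow>prism f g vs. coboundary ?F \<tau>))"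
    by (simp add: coboundary_Cons o_def sum_list_addf)
  have 2: "coboundary (\<lambda>\<tau>. \<Sum>\<rho>\<leftarrow>prism f g \<tau>. F \<rho>) (v # vs) =
     (\<Sum>\<tau>\<leftarrow>prism f g vs. F \<tau>) + (coboundary (\<lambda>\<tau>. ?F (g v # \<tau>)) (map g vs)
       + coboundary (\<lambda>\<tau>. \<Sum>\<rho>\<leftarrow>prism f g \<tau>. ?F \<rho>) vs)"
    by (simp add: coboundary_Cons o_def coboundary_add coboundary_map)
  have cancel: "a + (b + c) + (d + e) + (d + (c + h)) = a + b + (e + h)" for a b c d e h :: bit
    by (simp add: ac_simps bit_double)
  show ?case unfolding 1 2 cancel Cons.IH by (simp add: add.commute add.left_commute bit_double)
qed

lemma length_prism: "\<tau> \<in> set (prism f g \<sigma>) \<Longrightarrow> length \<tau> = Suc (length \<sigma>)"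
  by (induction \<sigma> arbitrary: \<tau>) auto

lemma set_prism: "\<tau> \<in> set (prism f g \<sigma>) \<Longrightarrow> set \<tau> \<subseteq> f ` set \<sigma> \<union> g ` set \<sigma>"
  by (induction \<sigma> arbitrary: \<tau>) (auto, blast+)

definition homotopy :: "(nat \<Rightarrow> 'a \<Rightarrow> 'b) \<Rightarrow> nat \<Rightarrow> 'a list \<Rightarrow> 'b list list" where
  "homotopy h n \<sigma> = concat (map (\<lambda>t. prism (h t) (h (Suc t)) \<sigma>) [0..<n])"

text \<open>
  In a stack of prisms the top of each one cancels the bottom of the next.
\<close>

lemma homotopy_boundary:
  "(\<Sum>\<tau>\<leftarrow>homotopy h n \<sigma>. coboundary F \<tau>) + coboundary (\<lambda>\<tau>. \<Sum>\<rho>\<leftarrow>homotopy h n \<tau>. F \<rho>) \<sigma>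
     = F (map (h 0) \<sigma>) + F (map (h n) \<sigma>)"
proof (induction n)
  case 0
  show ?case by (simp add: homotopy_def coboundary_def bit_double)
next
  case (Suc n)
  have cancel: "a + b = x + y \<Longrightarrow> c + d = y + z \<Longrightarrow> (a + c) + (b + d) = x + z" for a b c d x y z :: bit
  proof -
    assume "a + b = x + y" "c + d = y + z"
    then have "(a + b) + (c + d) = (x + y) + (y + z)" by simp
    then show "(a + c) + (b + d) = x + z" by (simp add: ac_simps bit_double)
  qed
  show ?case
    using cancel[OF Suc prism_homotopy[where f = "h n" and g = "h (Suc n)" and \<sigma> = \<sigma> and F = F]]
    by (simp add: homotopy_def coboundary_add)
qed

section \<open>Fan's alternating cochain\<close>

fun alternating :: "bool \<Rightarrow> bool list \<Rightarrow> bool" where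
  "alternating b [] = True"
| "alternating b (s # ss) = (s = b \<and> alternating (\<not> b) ss)"

definition alternation :: "bool \<Rightarrow> bool list \<Rightarrow> bit" where
  "alternation b ss = of_bool (alternating b ss)"

text \<open>
  The local parity count behind Fan's lemma: deleting an entry of a sign sequence that is not
  alternating yields an even number of sequences alternating from \<open>b\<close>, whereas an alternating sequence
  has exactly one such face, obtained by deleting either its last or its first entry. The empty sequence
  has no faces, but it alternates from both signs, and its two terms cancel.
\<close>

lemma coboundary_alternation:
  "coboundary (alternation b) ss = alternation b ss + alternation (\<not> b) ss"
proof (induction ss arbitrary: b)
  case (Cons s ss)
  show ?case
  proof (cases "s = b")
    case True
    then have "alternation b (s # \<tau>) = alternation (\<not> b) \<tau>" "alternation (\<not> b) (s # \<tau>) = 0" for \<tau>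
      by (auto simp: alternation_def)
    then show ?thesis
      by (simp add: coboundary_Cons Cons.IH add.commute[of "alternation (\<not> b) ss"] bit_double)
  next
    case False
    then have "alternation b (s # \<tau>) = 0" "alternation (\<not> b) (s # \<tau>) = alternation b \<tau>" for \<tau>
      by (auto simp: alternation_def)
    then show ?thesis by (simp add: coboundary_Cons coboundary_zero)
  qed
qed (simp add: alternation_def bit_double)

lemma alternating_Not: "alternating b (map Not ss) = alternating (\<not> b) ss"
  by (induction ss arbitrary: b) auto

text \<open>
  Inserting a new element commutes with deleting an old one, so the faces of the sorted list are the
  sorted faces. This lets the sign count, which depends on the order of the entries, be applied to
  simplices whose vertices are listed in any order.
\<close>

lemma coboundary_insort_key:
  assumes "sorted (map k xs)"
  shows "coboundary F (insort_key k v xs) = F xs + coboundary (\<lambda>\<tau>. F (insort_key k v \<tau>)) xs"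
  using assms
proof (induction xs arbitrary: F)
  case Nil
  then show ?case by (simp add: coboundary_def)
next
  case (Cons x xs)
  show ?case
  proof (cases "k v \<le> k x")
    case True
    then have "insort_key k v xs = v # xs"
      using Cons.prems by (cases xs) auto
    with True show ?thesis by (simp add: coboundary_Cons)
  next
    case False
    then show ?thesis
      using Cons.IH[of "\<lambda>\<tau>. F (x # \<tau>)"] Cons.prems
      by (simp add: coboundary_Cons ac_simps)
  qed
qed

lemma coboundary_sort_key:
  "coboundary (\<lambda>\<tau>. F (sort_key k \<tau>)) \<sigma> = coboundary F (sort_key k \<sigma>)"
proof (induction \<sigma> arbitrary: F)
  case (Cons v \<sigma>)
  show ?case
    using Cons.IH[of "\<lambda>\<tau>. F (insort_key k v \<tau>)"]
    by (simp add: coboundary_Cons coboundary_insort_key)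
qed simp

definition alternating_cochain :: "('a \<Rightarrow> nat) \<Rightarrow> ('a \<Rightarrow> bool) \<Rightarrow> 'a list \<Rightarrow> bit" where
  "alternating_cochain key pos \<sigma> = alternation True (map pos (sort_key key \<sigma>))"

lemma sort_key_map_invariant:
  assumes "\<And>x. x \<in> set \<sigma> \<Longrightarrow> key (\<nu> x) = key x"
  shows "sort_key key (map \<nu> \<sigma>) = map \<nu> (sort_key key \<sigma>)"
  using assms
proof (induction \<sigma>)
  case (Cons v \<sigma>)
  have *: "insort_key key (\<nu> v) (map \<nu> xs) = map \<nu> (insort_key key v xs)" if "set xs \<subseteq> set (v # \<sigma>)" for xs
    using that Cons.prems by (induction xs) auto
  show ?case using Cons.IH Cons.prems *[of "sort_key key \<sigma>"] by fastforce
qed simp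

text \<open>
  A simplex is counted when its signs alternate, starting with a positive one, once its vertices are
  sorted by key. If \<open>\<nu>\<close> preserves keys and flips signs, the sequences alternating from a negative sign
  are those counted on the image under \<open>\<nu>\<close>; hence the coboundary is the sum of the cochain and its
  translate by \<open>\<nu>\<close>.
\<close>

lemma coboundary_alternating_cochain:
  assumes "\<And>x. x \<in> set \<sigma> \<Longrightarrow> key (\<nu> x) = key x" and "\<And>x. x \<in> set \<sigma> \<Longrightarrow> pos (\<nu> x) = (\<not> pos x)"
  shows "coboundary (alternating_cochain key pos) \<sigma>
       = alternating_cochain key pos \<sigma> + alternating_cochain key pos (map \<nu> \<sigma>)"
proof -
  have "map pos (sort_key key (map \<nu> \<sigma>)) = map Not (map pos (sort_key key \<sigma>))"
    using assms by (simp add: sort_key_map_invariant)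
  then have "alternating_cochain key pos (map \<nu> \<sigma>) = alternation False (map pos (sort_key key \<sigma>))"
    by (simp add: alternating_cochain_def alternation_def alternating_Not del: map_map)
  moreover have "coboundary (alternating_cochain key pos) \<sigma>
      = coboundary (\<lambda>\<tau>. alternation True (map pos \<tau>)) (sort_key key \<sigma>)"
    unfolding alternating_cochain_def[abs_def] by (rule coboundary_sort_key)
  moreover have "\<dots> = coboundary (alternation True) (map pos (sort_key key \<sigma>))"
    by (rule coboundary_map[symmetric])
  ultimately show ?thesis
    by (simp add: alternating_cochain_def coboundary_alternation)
qed

lemma alternating_imp_strict:
  assumes "sorted (map key xs)" and "alternating b (map pos xs)"
    and "\<And>x y. x \<in> set xs \<Longrightarrow> y \<in> set xs \<Longrightarrow> key x = key y \<Longrightarrow> pos x = pos y"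
  shows "sorted_wrt (<) (map key xs)"
  using assms
proof (induction xs arbitrary: b)
  case (Cons x xs)
  have "sorted (map key xs)" "alternating (\<not> b) (map pos xs)"
    using Cons.prems(1,2) by auto
  then have IH: "sorted_wrt (<) (map key xs)"
    by (rule Cons.IH) (rule Cons.prems(3), simp_all)
  show ?case
  proof (cases xs)
    case (Cons y ys)
    then have "pos x \<noteq> pos y" using Cons.prems(2) by auto
    then have "key x \<noteq> key y" using Cons.prems(3)[of x y] Cons by force
    then have "key x < key y" using Cons.prems(1) Cons by auto
    then show ?thesis using IH Cons by force
  qed simp
qed simp

text \<open>
  Equal keys force equal signs, so along a counted simplex the keys increase strictly, and there are
  at most as many vertices as keys.
\<close>

lemma alternating_cochain_short:
  assumes "alternating_cochain key pos \<sigma> \<noteq> 0"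
    and "\<And>x y. x \<in> set \<sigma> \<Longrightarrow> y \<in> set \<sigma> \<Longrightarrow> key x = key y \<Longrightarrow> pos x = pos y"
    and "\<And>x. x \<in> set \<sigma> \<Longrightarrow> key x < n"
  shows "length \<sigma> \<le> n"
proof -
  let ?xs = "sort_key key \<sigma>"
  have "alternating True (map pos ?xs)"
    using assms(1) by (simp add: alternating_cochain_def alternation_def split: if_splits)
  then have "sorted_wrt (<) (map key ?xs)"
    by (rule alternating_imp_strict[rotated]) (simp, rule assms(2), simp_all)
  then have "distinct (map key ?xs)" by (simp add: strict_sorted_iff)
  then have "length ?xs = card (key ` set \<sigma>)"
    using distinct_card[of "map key ?xs"] by simp
  also have "\<dots> \<le> card {..<n}"
    using assms(3) by (intro card_mono) auto
  finally show ?thesis by simp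
qed

section \<open>A Lusternik-Schnirelmann bound for the boundary of a box\<close>

text \<open>
  The lattice points on the boundary of the cube of side \<open>2 * r\<close> in dimension \<open>d\<close>, a discrete sphere of
  dimension \<open>d - 1\<close>. Padding with zeros makes the spheres for increasing \<open>d\<close> a chain of equators.
\<close>

definition box_sphere :: "nat \<Rightarrow> nat \<Rightarrow> (nat \<Rightarrow> int) set" where
  "box_sphere d r = {x. (\<forall>j. \<bar>x j\<bar> \<le> int r) \<and> (\<forall>j\<ge>d. x j = 0) \<and> (\<exists>j. \<bar>x j\<bar> = int r)}"

definition near :: "(nat \<Rightarrow> int) \<Rightarrow> (nat \<Rightarrow> int) \<Rightarrow> bool" where
  "near x y \<longleftrightarrow> (\<forall>j. \<bar>x j - y j\<bar> \<le> 1)"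

definition antipode :: "(nat \<Rightarrow> int) \<Rightarrow> nat \<Rightarrow> int" where
  "antipode x = (\<lambda>j. - x j)"

lemma antipode_antipode [simp]: "antipode (antipode x) = x"
  by (simp add: antipode_def)

lemma near_antipode [simp]: "near (antipode x) (antipode y) = near x y"
  by (simp add: near_def antipode_def abs_minus_commute)

lemma antipode_box_sphere [simp]: "antipode x \<in> box_sphere d r \<longleftrightarrow> x \<in> box_sphere d r"
  by (simp add: box_sphere_def antipode_def)

lemma box_sphere_mono: "d \<le> d' \<Longrightarrow> box_sphere d r \<subseteq> box_sphere d' r"
  by (auto simp: box_sphere_def)

definition small_simplices :: "(nat \<Rightarrow> int) set \<Rightarrow> (nat \<Rightarrow> int) list set" where
  "small_simplices X = {\<sigma>. set \<sigma> \<subseteq> X \<and> (\<forall>x\<in>set \<sigma>. \<forall>y\<in>set \<sigma>. near x y)}"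

definition cap :: "nat \<Rightarrow> nat \<Rightarrow> (nat \<Rightarrow> int) set" where
  "cap k r = {x \<in> box_sphere (Suc k) r. 0 \<le> x k}"

text \<open>
  A contraction of the closed hemisphere \<open>cap k r\<close> in \<open>2 * r\<close> steps. For \<open>t \<le> r\<close> coordinate \<open>k\<close> is raised to
  at least \<open>t\<close>, while all points stay on the boundary of the cube; from then on coordinate \<open>k\<close> is \<open>r\<close>, and
  the other coordinates are clamped to \<open>[-(2 * r - t), 2 * r - t]\<close> until only the pole remains.
\<close>

definition contraction :: "nat \<Rightarrow> nat \<Rightarrow> nat \<Rightarrow> (nat \<Rightarrow> int) \<Rightarrow> nat \<Rightarrow> int" where
  "contraction k r t x = (\<lambda>j. if j = k then max (x j) (min (int t) (int r))
     else let u = min (int r) (2 * int r - int t) in max (- u) (min (x j) u))"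

definition pole :: "nat \<Rightarrow> nat \<Rightarrow> nat \<Rightarrow> int" where
  "pole k r = (\<lambda>j. if j = k then int r else 0)"

lemma capD:
  assumes "x \<in> cap k r"
  shows "- int r \<le> x j" "x j \<le> int r" "k < j \<Longrightarrow> x j = 0" "0 \<le> x k"
proof -
  have "\<bar>x j\<bar> \<le> int r" using assms by (simp add: cap_def box_sphere_def)
  then show "- int r \<le> x j" "x j \<le> int r" by linarith+
qed (use assms in \<open>auto simp: cap_def box_sphere_def\<close>)

lemma contraction_0:
  assumes "x \<in> cap k r"
  shows "contraction k r 0 x = x"
proof
  fix j
  show "contraction k r 0 x j = x j"
    using capD(1,2)[OF assms, of j] capD(4)[OF assms] by (simp add: contraction_def Let_def)
qed

lemma contraction_end:
  assumes "x \<in> cap k r"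
  shows "contraction k r (2 * r) x = pole k r"
proof
  fix j
  show "contraction k r (2 * r) x j = pole k r j"
    using capD(1,2)[OF assms, of j] by (auto simp: contraction_def pole_def Let_def)
qed

lemma contraction_in_cap:
  assumes "x \<in> cap k r" "t \<le> 2 * r"
  shows "contraction k r t x \<in> cap k r"
proof -
  have x: "\<bar>x j\<bar> \<le> int r" "j \<ge> Suc k \<Longrightarrow> x j = 0" "0 \<le> x k" for j
    using assms(1) by (auto simp: cap_def box_sphere_def)
  obtain i where i: "\<bar>x i\<bar> = int r" using assms(1) by (auto simp: cap_def box_sphere_def)
  have "\<bar>contraction k r t x j\<bar> \<le> int r" for j
    using x(1)[of j] x(3) assms(2) by (auto simp: contraction_def Let_def)
  moreover have "contraction k r t x j = 0" if "j \<ge> Suc k" for j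
    using x(2)[OF that] that assms(2) by (auto simp: contraction_def Let_def)
  \<comment> \<open>While coordinate \<open>k\<close> is being raised, the extreme coordinate \<open>i\<close> survives; later \<open>k\<close> is extreme.\<close>
  moreover have "\<bar>contraction k r t x (if t \<le> r then i else k)\<bar> = int r"
    using i x(1)[of i] x(1)[of k] x(3) by (auto simp: contraction_def Let_def)
  moreover have "0 \<le> contraction k r t x k"
    using x(3) by (auto simp: contraction_def)
  ultimately show ?thesis unfolding cap_def box_sphere_def by blast
qed

lemma near_contraction:
  assumes "near x y" "t \<le> 2 * r"
  shows "near (contraction k r t x) (contraction k r t y)"
  unfolding near_def
proof
  fix j
  have "\<bar>max (x j) l - max (y j) l\<bar> \<le> 1" "\<bar>max (- u) (min (x j) u) - max (- u) (min (y j) u)\<bar> \<le> 1" for l u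
    using assms(1)[unfolded near_def, rule_format, of j] by (auto simp: max_def min_def)
  then show "\<bar>contraction k r t x j - contraction k r t y j\<bar> \<le> 1"
    by (auto simp: contraction_def Let_def)
qed

text \<open>
  Clamping at consecutive thresholds moves only points beyond the threshold, so that near points
  remain near even when they are taken at consecutive times. This is what makes prisms over small
  simplices consist of small simplices.
\<close>

lemma near_contraction_Suc:
  assumes "near x y" "Suc t \<le> 2 * r"
  shows "near (contraction k r t x) (contraction k r (Suc t) y)"
  unfolding near_def
proof
  fix j
  have xy: "\<bar>x j - y j\<bar> \<le> 1"
    using assms(1) by (simp add: near_def)
  have low: "\<bar>max (x j) l - max (y j) l'\<bar> \<le> 1" if "l \<le> l'" "l' \<le> l + 1" for l l'
    using xy that by (auto simp: max_def)
  have high: "\<bar>max (- u) (min (x j) u) - max (- u') (min (y j) u')\<bar> \<le> 1"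
    if "u' \<le> u" "u \<le> u' + 1" "0 \<le> u'" for u u'
    using xy that by (auto simp: max_def min_def)
  show "\<bar>contraction k r t x j - contraction k r (Suc t) y j\<bar> \<le> 1"
  proof (cases "j = k")
    case True
    then show ?thesis
      using low[of "min (int t) (int r)" "min (int (Suc t)) (int r)"] by (simp add: contraction_def)
  next
    case False
    have "2 * int r - int (Suc t) \<ge> 0" using assms(2) by linarith
    then show ?thesis
      using False high[of "min (int r) (2 * int r - int (Suc t))" "min (int r) (2 * int r - int t)"]
      by (simp add: contraction_def Let_def)
  qed
qed

lemma near_sym: "near x y \<Longrightarrow> near y x"
  by (simp add: near_def abs_minus_commute)

lemma prism_contraction_small:
  assumes \<sigma>: "\<sigma> \<in> small_simplices (cap k r)" and t: "Suc t \<le> 2 * r"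
    and \<tau>: "\<tau> \<in> set (prism (contraction k r t) (contraction k r (Suc t)) \<sigma>)"
  shows "\<tau> \<in> small_simplices (cap k r)"
proof -
  let ?f = "contraction k r t" and ?g = "contraction k r (Suc t)"
  have cap: "set \<sigma> \<subseteq> cap k r" using \<sigma> by (simp add: small_simplices_def)
  have near: "near x y" if "x \<in> set \<sigma>" "y \<in> set \<sigma>" for x y
    using \<sigma> that by (simp add: small_simplices_def)
  let ?U = "?f ` set \<sigma> \<union> ?g ` set \<sigma>"
  have sub: "set \<tau> \<subseteq> ?U" by (rule set_prism[OF \<tau>])
  have "near u v" if uv: "u \<in> ?U" "v \<in> ?U" for u v
  proof -
    obtain x where x: "x \<in> set \<sigma>" "u = ?f x \<or> u = ?g x" using uv(1) by blast
    obtain y where y: "y \<in> set \<sigma>" "v = ?f y \<or> v = ?g y" using uv(2) by blast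
    have "t \<le> 2 * r" using t by linarith
    then have 1: "near (?f x) (?f y)" and 2: "near (?g x) (?g y)"
      using near_contraction[OF near[OF x(1) y(1)]] t by simp_all
    have 3: "near (?f x) (?g y)"
      by (rule near_contraction_Suc[OF near[OF x(1) y(1)] t])
    have 4: "near (?g x) (?f y)"
      by (rule near_sym, rule near_contraction_Suc[OF near[OF y(1) x(1)] t])
    from x(2) y(2) show ?thesis
      by (elim disjE) (simp_all only: 1 2 3 4)
  qed
  then have "\<forall>u\<in>set \<tau>. \<forall>v\<in>set \<tau>. near u v"
    using sub by (simp add: subset_iff)
  moreover have "?U \<subseteq> cap k r"
  proof
    fix u assume "u \<in> ?U"
    then obtain x where "x \<in> set \<sigma>" "u = ?f x \<or> u = ?g x" by blast
    then show "u \<in> cap k r"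
      using contraction_in_cap[of x k r t] contraction_in_cap[of x k r "Suc t"] cap t
      by (auto dest: subsetD)
  qed
  ultimately show ?thesis using order_trans[OF sub] by (simp only: small_simplices_def mem_Collect_eq)
qed

lemma box_sphere_subset_cap: "box_sphere (Suc k) r \<subseteq> cap (Suc k) r"
  using box_sphere_mono[of "Suc k" "Suc (Suc k)" r] by (auto simp: cap_def box_sphere_def)

lemma small_simplices_mono: "X \<subseteq> Y \<Longrightarrow> small_simplices X \<subseteq> small_simplices Y"
  by (auto simp: small_simplices_def)

lemma antipode_small_simplices:
  "\<sigma> \<in> small_simplices (box_sphere d r) \<Longrightarrow> map antipode \<sigma> \<in> small_simplices (box_sphere d r)"
  by (auto simp: small_simplices_def)

definition symmetrize :: "(nat \<Rightarrow> int) list list \<Rightarrow> (nat \<Rightarrow> int) list list" where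
  "symmetrize c = c @ map (map antipode) c"

lemma sum_symmetrize_antipode:
  "(\<Sum>\<sigma>\<leftarrow>symmetrize c. F (map antipode \<sigma>)) = (\<Sum>\<sigma>\<leftarrow>symmetrize c. F \<sigma>)" for F :: "_ \<Rightarrow> bit"
  by (simp add: symmetrize_def o_def add.commute)

lemma sum_symmetrize_const: "(\<Sum>\<sigma>\<leftarrow>symmetrize c. b) = (0::bit)"
  by (simp add: symmetrize_def o_def bit_double)

text \<open>
  The trace of a chain under the contraction of a hemisphere, playing the part of a cone over it.
\<close>

definition cone_chain :: "nat \<Rightarrow> nat \<Rightarrow> (nat \<Rightarrow> int) list list \<Rightarrow> (nat \<Rightarrow> int) list list" where
  "cone_chain k r z = concat (map (homotopy (contraction k r) (2 * r)) z)"

lemma sum_concat_map: "(\<Sum>x\<leftarrow>concat (map f xs). g x) = (\<Sum>x\<leftarrow>xs. \<Sum>y\<leftarrow>f x. g y)"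
  for g :: "_ \<Rightarrow> 'm::comm_monoid_add"
  by (induction xs) auto

text \<open>
  The homotopy formula for a cycle, whose last term is the constant simplex at the pole, taken once
  for each of the evenly many simplices of the cycle.
\<close>

lemma cone_chain_boundary:
  assumes z: "\<And>\<sigma>. \<sigma> \<in> set z \<Longrightarrow> set \<sigma> \<subseteq> cap k r \<and> length \<sigma> = n"
    and cycle: "\<And>F. (\<Sum>\<sigma>\<leftarrow>z. coboundary F \<sigma>) = 0"
    and even: "\<And>b::bit. (\<Sum>\<sigma>\<leftarrow>z. b) = 0"
  shows "(\<Sum>\<sigma>\<leftarrow>cone_chain k r z. coboundary F \<sigma>) = (\<Sum>\<sigma>\<leftarrow>z. F \<sigma>)"
proof -
  let ?h = "contraction k r" and ?K = "homotopy (contraction k r) (2 * r)"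
  have step: "(\<Sum>\<tau>\<leftarrow>?K \<sigma>. coboundary F \<tau>)
      = coboundary (\<lambda>\<tau>. \<Sum>\<rho>\<leftarrow>?K \<tau>. F \<rho>) \<sigma> + (F \<sigma> + F (replicate n (pole k r)))" if "\<sigma> \<in> set z" for \<sigma>
  proof -
    have "map (?h 0) \<sigma> = \<sigma>"
      using z[OF that] by (intro map_idI contraction_0) auto
    moreover have "map (?h (2 * r)) \<sigma> = replicate n (pole k r)"
      using z[OF that] by (intro replicate_eqI) (auto simp: contraction_end)
    moreover have "a + b = c \<Longrightarrow> a = b + c" for a b c :: bit
      by (cases a; cases b; cases c; simp)
    ultimately show ?thesis
      using homotopy_boundary[of F ?h "2 * r" \<sigma>] by metis
  qed
  have "(\<Sum>\<sigma>\<leftarrow>cone_chain k r z. coboundary F \<sigma>) = (\<Sum>\<sigma>\<leftarrow>z. \<Sum>\<tau>\<leftarrow>?K \<sigma>. coboundary F \<tau>)"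
    unfolding cone_chain_def by (rule sum_concat_map)
  also have "\<dots> = (\<Sum>\<sigma>\<leftarrow>z. coboundary (\<lambda>\<tau>. \<Sum>\<rho>\<leftarrow>?K \<tau>. F \<rho>) \<sigma> + (F \<sigma> + F (replicate n (pole k r))))"
    by (intro arg_cong[of _ _ sum_list] map_cong refl step)
  also have "\<dots> = (\<Sum>\<sigma>\<leftarrow>z. F \<sigma>)"
    by (simp add: sum_list_addf cycle even)
  finally show ?thesis .
qed

lemma cone_chain_simplices:
  assumes "\<And>\<sigma>. \<sigma> \<in> set z \<Longrightarrow> \<sigma> \<in> small_simplices (cap k r) \<and> length \<sigma> = n"
    and "\<tau> \<in> set (cone_chain k r z)"
  shows "\<tau> \<in> small_simplices (cap k r)" "length \<tau> = Suc n"
proof -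
  obtain \<sigma> t where "\<sigma> \<in> set z" "t < 2 * r" "\<tau> \<in> set (prism (contraction k r t) (contraction k r (Suc t)) \<sigma>)"
    using assms(2) by (auto simp: cone_chain_def homotopy_def)
  with assms(1)[of \<sigma>] show "\<tau> \<in> small_simplices (cap k r)" "length \<tau> = Suc n"
    by (simp_all add: prism_contraction_small[of \<sigma> k r t \<tau>] length_prism)
qed

text \<open>
  Induction builds a chain \<open>c\<close> that fills a hemisphere of dimension \<open>k\<close>, while its symmetrization, which
  stands for the whole sphere of dimension \<open>k\<close>, is a cycle. This cycle lies on the equator of the next
  sphere, and its cone is the next \<open>c\<close>. The parity of \<open>F\<close> on the spheres is the same in all dimensions:
  on the symmetrization of \<open>c\<close> the cochain sums to the sum of its coboundary over \<open>c\<close>, that is, to its sum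
  over the boundary of \<open>c\<close>, which is the previous sphere.
\<close>

lemma hemisphere_chain:
  assumes F: "\<And>\<sigma>. \<sigma> \<in> small_simplices (box_sphere d r) \<Longrightarrow> coboundary F \<sigma> = F \<sigma> + F (map antipode \<sigma>)"
    and F1: "F [] = 1" and "k < d"
  shows "\<exists>c. (\<forall>\<sigma>\<in>set c. \<sigma> \<in> small_simplices (cap k r) \<and> length \<sigma> = Suc k)
           \<and> (\<forall>H. (\<Sum>\<sigma>\<leftarrow>symmetrize c. coboundary H \<sigma>) = 0)
           \<and> (\<Sum>\<sigma>\<leftarrow>symmetrize c. F \<sigma>) = 1"
  using \<open>k < d\<close>
proof (induction k)
  case 0
  have pole: "pole 0 r \<in> cap 0 r"
    by (auto simp: pole_def cap_def box_sphere_def)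
  then have simplex: "[pole 0 r] \<in> small_simplices (cap 0 r)"
    by (simp add: small_simplices_def near_def)
  have "cap 0 r \<subseteq> box_sphere d r"
    using box_sphere_mono[of "Suc 0" d r] 0 by (auto simp: cap_def)
  then have "coboundary F [pole 0 r] = F [pole 0 r] + F [antipode (pole 0 r)]"
    using F[of "[pole 0 r]"] subsetD[OF small_simplices_mono _] simplex by simp
  then have "(\<Sum>\<sigma>\<leftarrow>symmetrize [[pole 0 r]]. F \<sigma>) = 1"
    using F1 by (simp add: symmetrize_def coboundary_Cons)
  moreover have "(\<Sum>\<sigma>\<leftarrow>symmetrize [[pole 0 r]]. coboundary H \<sigma>) = 0" for H
    by (simp add: symmetrize_def coboundary_Cons bit_double)
  ultimately show ?case using simplex by (intro exI[of _ "[[pole 0 r]]"]) auto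
next
  case (Suc k)
  then obtain c where c: "\<And>\<sigma>. \<sigma> \<in> set c \<Longrightarrow> \<sigma> \<in> small_simplices (cap k r) \<and> length \<sigma> = Suc k"
    and cycle: "\<And>H. (\<Sum>\<sigma>\<leftarrow>symmetrize c. coboundary H \<sigma>) = 0"
    and odd: "(\<Sum>\<sigma>\<leftarrow>symmetrize c. F \<sigma>) = 1" by auto
  let ?z = "symmetrize c" and ?c = "cone_chain (Suc k) r (symmetrize c)"
  have c_sphere: "\<sigma> \<in> small_simplices (box_sphere (Suc k) r)" if "\<sigma> \<in> set c" for \<sigma>
    using c[OF that] by (auto simp: small_simplices_def cap_def)
  have z: "\<sigma> \<in> small_simplices (cap (Suc k) r) \<and> length \<sigma> = Suc k" if "\<sigma> \<in> set ?z" for \<sigma>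
  proof -
    from that consider "\<sigma> \<in> set c" | \<rho> where "\<rho> \<in> set c" "\<sigma> = map antipode \<rho>"
      by (auto simp: symmetrize_def)
    then have "\<sigma> \<in> small_simplices (box_sphere (Suc k) r) \<and> length \<sigma> = Suc k"
      by cases (use c c_sphere antipode_small_simplices in simp_all)
    then show ?thesis
      using small_simplices_mono[OF box_sphere_subset_cap] by blast
  qed
  have bd: "(\<Sum>\<sigma>\<leftarrow>?c. coboundary H \<sigma>) = (\<Sum>\<sigma>\<leftarrow>?z. H \<sigma>)" for H
    by (rule cone_chain_boundary[where n = "Suc k"])
      (use z cycle sum_symmetrize_const in \<open>simp_all add: small_simplices_def\<close>)
  have simplices: "\<sigma> \<in> small_simplices (cap (Suc k) r) \<and> length \<sigma> = Suc (Suc k)" if "\<sigma> \<in> set ?c" for \<sigma>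
    using cone_chain_simplices[OF z that] by auto
  have sym: "(\<Sum>\<sigma>\<leftarrow>symmetrize ?c. H \<sigma>) = (\<Sum>\<sigma>\<leftarrow>?c. H \<sigma>) + (\<Sum>\<sigma>\<leftarrow>?c. H (map antipode \<sigma>))" for H :: "_ \<Rightarrow> bit"
    by (simp add: symmetrize_def o_def)
  have "(\<Sum>\<sigma>\<leftarrow>symmetrize ?c. coboundary H \<sigma>) = 0" for H
    unfolding sym coboundary_map bd sum_symmetrize_antipode by (rule bit_double)
  moreover have "(\<Sum>\<sigma>\<leftarrow>symmetrize ?c. F \<sigma>) = 1"
  proof -
    have "cap (Suc k) r \<subseteq> box_sphere d r"
      using box_sphere_mono[of "Suc (Suc k)" d r] Suc.prems by (auto simp: cap_def)
    then have "F \<sigma> + F (map antipode \<sigma>) = coboundary F \<sigma>" if "\<sigma> \<in> set ?c" for \<sigma>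
      using F[of \<sigma>] subsetD[OF small_simplices_mono, of "cap (Suc k) r" "box_sphere d r" \<sigma>] simplices[OF that]
      by simp
    then have "(\<Sum>\<sigma>\<leftarrow>?c. F \<sigma> + F (map antipode \<sigma>)) = (\<Sum>\<sigma>\<leftarrow>?c. coboundary F \<sigma>)"
      by (intro arg_cong[of _ _ sum_list] map_cong refl)
    then show ?thesis by (simp add: sym bd odd sum_list_addf)
  qed
  ultimately show ?case using simplices by blast
qed

text \<open>
  Label \<open>x\<close> with the smaller of the colours of \<open>x\<close> and its antipode, and with the sign that tells which of
  the two has it. Near points with the same label have the same sign, since otherwise one of them
  would have the colour of a point near the antipode of the other. By parity there is an alternating
  simplex of dimension \<open>d - 1\<close>, and its \<open>d\<close> labels are distinct. The largest colour never is a label.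
\<close>

lemma box_sphere_colouring_bound:
  fixes col :: "(nat \<Rightarrow> int) \<Rightarrow> nat"
  assumes "0 < d" and "\<And>x. x \<in> box_sphere d r \<Longrightarrow> col x < q"
    and proper: "\<And>x y. x \<in> box_sphere d r \<Longrightarrow> y \<in> box_sphere d r \<Longrightarrow> near x (antipode y) \<Longrightarrow> col x \<noteq> col y"
  shows "d < q"
proof -
  define key where "key x = min (col x) (col (antipode x))" for x
  define pos where "pos x \<longleftrightarrow> col x < col (antipode x)" for x
  have anti: "col x \<noteq> col (antipode x)" if "x \<in> box_sphere d r" for x
    using proper[of x "antipode x"] that by (simp add: near_def)
  let ?F = "alternating_cochain key pos"
  have F: "coboundary ?F \<sigma> = ?F \<sigma> + ?F (map antipode \<sigma>)" if "\<sigma> \<in> small_simplices (box_sphere d r)" for \<sigma>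
  proof (rule coboundary_alternating_cochain)
    fix x assume "x \<in> set \<sigma>"
    then have "x \<in> box_sphere d r" using that by (auto simp: small_simplices_def)
    then show "pos (antipode x) = (\<not> pos x)" using anti[of x] by (auto simp: pos_def)
  qed (simp add: key_def min.commute)
  have "?F [] = 1" by (simp add: alternating_cochain_def alternation_def)
  moreover have "d - 1 < d" using \<open>0 < d\<close> by simp
  ultimately obtain c where c: "\<And>\<sigma>. \<sigma> \<in> set c \<Longrightarrow> \<sigma> \<in> small_simplices (cap (d - 1) r) \<and> length \<sigma> = Suc (d - 1)"
    and odd: "(\<Sum>\<sigma>\<leftarrow>symmetrize c. ?F \<sigma>) = 1"
    using hemisphere_chain[of d r ?F "d - 1"] F by blast
  obtain \<sigma> where \<sigma>: "\<sigma> \<in> set (symmetrize c)" "?F \<sigma> \<noteq> 0"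
  proof -
    have "(\<Sum>\<sigma>\<leftarrow>z. ?F \<sigma>) = 0" if "\<forall>\<sigma>\<in>set z. ?F \<sigma> = 0" for z
      using that by (induction z) auto
    then show ?thesis using odd that by fastforce
  qed
  have "cap (d - 1) r \<subseteq> box_sphere d r" using \<open>0 < d\<close> by (auto simp: cap_def)
  then have c': "\<rho> \<in> small_simplices (box_sphere d r) \<and> length \<rho> = d" if "\<rho> \<in> set c" for \<rho>
    using c[OF that] subsetD[OF small_simplices_mono] \<open>0 < d\<close> by simp
  from \<sigma>(1) consider "\<sigma> \<in> set c" | \<rho> where "\<rho> \<in> set c" "\<sigma> = map antipode \<rho>"
    by (auto simp: symmetrize_def)
  then have "\<sigma> \<in> small_simplices (box_sphere d r) \<and> length \<sigma> = d"
    by cases (use c' antipode_small_simplices in simp_all)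
  then have simplex: "\<sigma> \<in> small_simplices (box_sphere d r)" and len: "length \<sigma> = d" by simp_all
  have "length \<sigma> \<le> q - 1"
  proof (rule alternating_cochain_short[OF \<sigma>(2)])
    fix x y assume xy: "x \<in> set \<sigma>" "y \<in> set \<sigma>" "key x = key y"
    have S: "x \<in> box_sphere d r" "y \<in> box_sphere d r" and near: "near x y"
      using simplex xy by (auto simp: small_simplices_def)
    then have "col x \<noteq> col (antipode y)" "col (antipode x) \<noteq> col y"
      using proper[of x "antipode y"] proper[of "antipode x" y] by simp_all
    then show "pos x = pos y" using xy(3) by (auto simp: key_def pos_def min_def split: if_splits)
  next
    fix x assume "x \<in> set \<sigma>"
    then have "x \<in> box_sphere d r" using simplex by (auto simp: small_simplices_def)
    then show "key x < q - 1"
      using assms(2)[of x] assms(2)[of "antipode x"] anti[of x] by (auto simp: key_def min_def)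
  qed
  then show ?thesis using len \<open>0 < d\<close> by linarith
qed

section \<open>Koenig's theorem\<close>

definition covers :: "'a set \<Rightarrow> ('a \<times> 'a) set \<Rightarrow> bool" where
  "covers X E \<longleftrightarrow> (\<forall>(a, b)\<in>E. a \<in> X \<or> b \<in> X)"

definition matching :: "('a \<times> 'a) set \<Rightarrow> bool" where
  "matching M \<longleftrightarrow> inj_on fst M \<and> inj_on snd M"

text \<open>
  The uncrossing step of the proof of Koenig's theorem by Lovasz and Plummer. The set \<open>D\<close> consists of the
  common end \<open>v\<close> of the two edges and the vertices in exactly one of the covers. Every edge either meets
  both covers in a common vertex or has both ends in \<open>D\<close>; as the graph is bipartite, the smaller side
  of \<open>D\<close> covers the edges of the second kind.
\<close>

lemma cover_uncrossing:
  assumes fin: "finite S" "finite S'" and "A \<inter> B = {}" and E: "E \<subseteq> A \<times> B"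
    and cov: "covers S (E - {e})" "covers S' (E - {e'})"
    and ends: "e = (a, b)" "e' = (a', b')" "e \<noteq> e'" "e \<in> E" "e' \<in> E"
    and v: "v \<in> {a, b}" "v \<in> {a', b'}"
    and out: "a \<notin> S" "b \<notin> S" "a' \<notin> S'" "b' \<notin> S'"
  shows "\<exists>X. finite X \<and> covers X E \<and> 2 * card X \<le> card S + card S' + 1"
proof -
  define D where "D = insert v ((S - S') \<union> (S' - S))"
  let ?T = "if card (D \<inter> A) \<le> card (D \<inter> B) then D \<inter> A else D \<inter> B"
  have finD: "finite D" using fin by (simp add: D_def)
  have vD: "v \<notin> S" "v \<notin> S'" using v out by auto
  have "x \<in> ?T \<union> (S \<inter> S') \<or> y \<in> ?T \<union> (S \<inter> S')" if xy: "(x, y) \<in> E" for x y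
  proof (rule ccontr)
    assume *: "\<not> ?thesis"
    have AB: "x \<in> A" "y \<in> B" using xy E by auto
    have S: "x \<in> S \<or> y \<in> S" if "(x, y) \<noteq> e" using cov(1) xy that by (auto simp: covers_def)
    have S': "x \<in> S' \<or> y \<in> S'" if "(x, y) \<noteq> e'" using cov(2) xy that by (auto simp: covers_def)
    have "x \<in> D \<and> y \<in> D"
      using S S' * v out ends by (auto simp: D_def)
    then show False using * AB by (auto split: if_splits)
  qed
  then have "covers (?T \<union> (S \<inter> S')) E" unfolding covers_def by blast
  moreover have "2 * card ?T \<le> card D"
  proof -
    have "card (D \<inter> A) + card (D \<inter> B) = card ((D \<inter> A) \<union> (D \<inter> B))"
      using finD \<open>A \<inter> B = {}\<close> by (intro card_Un_disjoint[symmetric]) auto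
    also have "\<dots> \<le> card D" by (intro card_mono finD) auto
    finally show ?thesis by auto
  qed
  moreover have "card D = card (S - S') + card (S' - S) + 1"
  proof -
    have "card ((S - S') \<union> (S' - S)) = card (S - S') + card (S' - S)"
      using fin by (intro card_Un_disjoint) auto
    then show ?thesis using fin vD by (simp add: D_def)
  qed
  moreover have "card (?T \<union> (S \<inter> S')) \<le> card ?T + card (S \<inter> S')" by (rule card_Un_le)
  moreover have "card S = card (S - S') + card (S \<inter> S')" "card S' = card (S' - S) + card (S \<inter> S')"
    using fin by (metis card_Diff_subset_Int card_Int_Diff finite_Int add.commute Int_commute)+
  moreover have "finite (?T \<union> (S \<inter> S'))" using finD fin by auto
  ultimately show ?thesis by (intro exI[of _ "?T \<union> (S \<inter> S')"]) linarith
qed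

text \<open>
  If some edge can be deleted without decreasing the cover number, induction applies. Otherwise every
  edge is critical, and two edges with a common end would, by uncrossing, give a cover that is too
  small; so the edges themselves form a matching.
\<close>

lemma Koenig:
  assumes "finite E" "E \<subseteq> A \<times> B" "A \<inter> B = {}"
  shows "\<exists>M X. M \<subseteq> E \<and> matching M \<and> finite X \<and> covers X E \<and> card X = card M"
  using assms
proof (induction "card E" arbitrary: E rule: less_induct)
  case less
  define \<tau> where "\<tau> E' = (LEAST n. \<exists>X. finite X \<and> covers X E' \<and> card X = n)" for E' :: "('a \<times> 'a) set"
  have cover: "\<exists>X. finite X \<and> covers X E' \<and> card X = \<tau> E'" if "E' \<subseteq> E" for E'
    unfolding \<tau>_def
  proof (rule LeastI_ex)
    have "finite (fst ` E')" "covers (fst ` E') E'"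
      using finite_subset[OF that less.prems(1)] by (force simp: covers_def)+
    then show "\<exists>n X. finite X \<and> covers X E' \<and> card X = n" by blast
  qed
  have least: "\<tau> E' \<le> card X" if "finite X" "covers X E'" for X E'
    unfolding \<tau>_def using that by (intro Least_le) blast
  show ?case
  proof (cases "\<exists>e\<in>E. \<tau> E \<le> \<tau> (E - {e})")
    case True
    then obtain e where e: "e \<in> E" "\<tau> E \<le> \<tau> (E - {e})" by blast
    obtain M X where M: "M \<subseteq> E - {e}" "matching M" and X: "finite X" "covers X (E - {e})" "card X = card M"
      using less.hyps[of "E - {e}"] less.prems e(1) card_Diff1_less[of E e] by blast
    obtain Y where Y: "finite Y" "covers Y E" "card Y = \<tau> E" using cover[of E] by blast
    have "M \<subseteq> E" using M(1) by blast
    \<comment> \<open>Weak duality: a cover contains an end of each edge of \<open>M\<close>, and these ends are distinct.\<close>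
    have cYM: "card M \<le> card Y"
    proof -
      define f where "f m = (if fst m \<in> Y then fst m else snd m)" for m :: "'a \<times> 'a"
      have "inj_on f M"
      proof (rule inj_onI)
        fix m m' assume m: "m \<in> M" "m' \<in> M" "f m = f m'"
        have "fst m \<in> A" "snd m \<in> B" "fst m' \<in> A" "snd m' \<in> B"
          using m \<open>M \<subseteq> E\<close> less.prems(2) by auto
        then have "fst m = fst m' \<or> snd m = snd m'"
          using m(3) less.prems(3) by (auto simp: f_def split: if_splits)
        then show "m = m'" using M(2) m by (auto simp: matching_def inj_on_def)
      qed
      moreover have "f ` M \<subseteq> Y" using Y(2) \<open>M \<subseteq> E\<close> by (force simp: f_def covers_def)
      ultimately show ?thesis using card_inj_on_le Y(1) by blast
    qed
    have "card Y \<le> card M" using least[OF X(1,2)] e(2) X(3) Y(3) by linarith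
    then show ?thesis using cYM \<open>M \<subseteq> E\<close> M(2) Y by (intro exI[of _ M] exI[of _ Y]) auto
  next
    case critical: False
    have "matching E"
    proof (rule ccontr)
      assume "\<not> matching E"
      then obtain a b a' b' v where ends: "(a, b) \<in> E" "(a', b') \<in> E" "(a, b) \<noteq> (a', b')"
        and v: "v \<in> {a, b}" "v \<in> {a', b'}"
        unfolding matching_def inj_on_def by (metis insertCI prod.collapse)
      have *: "\<exists>S. finite S \<and> covers S (E - {(a, b)}) \<and> a \<notin> S \<and> b \<notin> S \<and> card S < \<tau> E" if "(a, b) \<in> E" for a b
      proof -
        obtain S where S: "finite S" "covers S (E - {(a, b)})" "card S = \<tau> (E - {(a, b)})"
          using cover[of "E - {(a, b)}"] by blast
        moreover have "card S < \<tau> E" using critical that S(3) by auto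
        moreover have "a \<notin> S \<and> b \<notin> S"
        proof (rule ccontr)
          assume "\<not> (a \<notin> S \<and> b \<notin> S)"
          then have "covers S E" using S(2) by (auto simp: covers_def)
          then show False using least[OF S(1)] \<open>card S < \<tau> E\<close> by fastforce
        qed
        ultimately show ?thesis by blast
      qed
      obtain S where S: "finite S" "covers S (E - {(a, b)})" "a \<notin> S" "b \<notin> S" "card S < \<tau> E"
        using *[OF ends(1)] by blast
      obtain S' where S': "finite S'" "covers S' (E - {(a', b')})" "a' \<notin> S'" "b' \<notin> S'" "card S' < \<tau> E"
        using *[OF ends(2)] by blast
      obtain X where X: "finite X" "covers X E" "2 * card X \<le> card S + card S' + 1"
        using cover_uncrossing[OF S(1) S'(1) less.prems(3,2) S(2) S'(2) refl refl ends(3,1,2) v S(3,4) S'(3,4)]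
        by blast
      then show False using least[OF X(1,2)] S(5) S'(5) by linarith
    qed
    then have "card (fst ` E) = card E" by (simp add: matching_def card_image)
    moreover have "covers (fst ` E) E" by (force simp: covers_def)
    ultimately show ?thesis using \<open>matching E\<close> less.prems(1)
      by (intro exI[of _ E] exI[of _ "fst ` E"]) simp
  qed
qed

text \<open>
  The perfection of complements of bipartite graphs: a maximum matching together with the unmatched
  vertices covers everything with as many sets as there are vertices outside a minimum vertex cover.
\<close>

lemma bipartite_edge_cover:
  fixes R :: "'a \<Rightarrow> 'a \<Rightarrow> bool"
  assumes fin: "finite A" "finite B" and disj: "A \<inter> B = {}" and sym: "\<And>x y. R x y \<Longrightarrow> R y x"
    and indep: "\<And>x y. x \<in> A \<Longrightarrow> y \<in> A \<Longrightarrow> \<not> R x y" "\<And>x y. x \<in> B \<Longrightarrow> y \<in> B \<Longrightarrow> \<not> R x y"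
  shows "\<exists>C I. finite C \<and> \<Union>C = A \<union> B \<and> (\<forall>K\<in>C. \<forall>x\<in>K. \<forall>y\<in>K. x \<noteq> y \<longrightarrow> R x y)
           \<and> I \<subseteq> A \<union> B \<and> (\<forall>x\<in>I. \<forall>y\<in>I. \<not> R x y) \<and> card C \<le> card I"
proof -
  define E where "E = {(a, b). a \<in> A \<and> b \<in> B \<and> R a b}"
  have E: "E \<subseteq> A \<times> B" by (auto simp: E_def)
  then have "finite E" using fin finite_subset by blast
  from Koenig[OF this E disj] obtain M X
    where M: "M \<subseteq> E" "matching M" and X: "finite X" "covers X E" "card X = card M" by blast
  have finM: "finite M" using M(1) \<open>finite E\<close> finite_subset by blast
  define U where "U = (A - fst ` M) \<union> (B - snd ` M)"
  define C where "C = (\<lambda>(a, b). {a, b}) ` M \<union> (\<lambda>x. {x}) ` U"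
  define I where "I = (A \<union> B) - X"
  have sub: "fst ` M \<subseteq> A" "snd ` M \<subseteq> B" using M(1) E by auto
  have "card U = card (A - fst ` M) + card (B - snd ` M)"
    unfolding U_def using fin disj by (intro card_Un_disjoint) auto
  also have "\<dots> = (card A - card M) + (card B - card M)"
    using sub finM M(2) by (simp add: card_Diff_subset card_image matching_def)
  finally have cU: "card U = (card A - card M) + (card B - card M)" .
  have cM: "card M \<le> card A" "card M \<le> card B"
    using sub fin M(2) card_mono[of A "fst ` M"] card_mono[of B "snd ` M"] by (auto simp: card_image matching_def)
  have "card C \<le> card M + card U"
    unfolding C_def by (intro order_trans[OF card_Un_le] add_mono card_image_le finM) (use fin in \<open>simp add: U_def\<close>)
  also have "\<dots> = card (A \<union> B) - card X"
    using cU cM X(3) fin disj by (simp add: card_Un_disjoint)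
  also have "\<dots> \<le> card I" unfolding I_def by (rule diff_card_le_card_Diff[OF X(1)])
  finally have "card C \<le> card I" .
  moreover have "finite C" using finM fin by (simp add: C_def U_def)
  moreover have "\<Union>C = A \<union> B"
  proof -
    have "\<Union>C = fst ` M \<union> snd ` M \<union> U" by (force simp: C_def)
    then show ?thesis using sub by (auto simp: U_def)
  qed
  moreover have "\<forall>K\<in>C. \<forall>x\<in>K. \<forall>y\<in>K. x \<noteq> y \<longrightarrow> R x y"
  proof -
    have "R a b \<and> R b a" if "(a, b) \<in> M" for a b
      using that M(1) sym[of a b] by (auto simp: E_def)
    then show ?thesis by (auto simp: C_def)
  qed
  moreover have "\<not> R x y" if "x \<in> I" "y \<in> I" for x y
  proof
    assume "R x y"
    have "False" if "a \<in> I" "b \<in> I" "a \<in> A" "b \<in> B" "R a b" for a b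
      using that X(2) by (auto simp: I_def E_def covers_def)
    moreover have "x \<in> A \<and> y \<in> B \<or> x \<in> B \<and> y \<in> A"
      using \<open>R x y\<close> that indep by (auto simp: I_def)
    ultimately show False using that sym[OF \<open>R x y\<close>] \<open>R x y\<close> by metis
  qed
  moreover have "I \<subseteq> A \<union> B" by (auto simp: I_def)
  ultimately show ?thesis by (intro exI[of _ C] exI[of _ I]) simp
qed

section \<open>The Borsuk graph is nearly bipartite\<close>

definition opposite :: "(nat \<Rightarrow> int) \<Rightarrow> (nat \<Rightarrow> int) \<Rightarrow> bool" where
  "opposite x y \<longleftrightarrow> near x (antipode y)"

lemma opposite_iff: "opposite x y \<longleftrightarrow> (\<forall>j. \<bar>x j + y j\<bar> \<le> 1)"
  by (simp add: opposite_def near_def antipode_def)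

lemma opposite_sym: "opposite x y \<Longrightarrow> opposite y x"
  by (simp add: opposite_iff add.commute)

lemma opposite_irrefl:
  assumes "x \<in> box_sphere d r" "r > 0" shows "\<not> opposite x x"
proof
  assume "opposite x x"
  obtain i where i: "\<bar>x i\<bar> = int r" using assms by (auto simp: box_sphere_def)
  have "\<bar>x i + x i\<bar> \<le> 1" using \<open>opposite x x\<close> by (simp add: opposite_iff)
  then show False using i \<open>r > 0\<close> by linarith
qed

text \<open>
  Going around a triangle, a coordinate of absolute value \<open>r\<close> changes sign three times up to errors of 1,
  so that its double has absolute value at most 3.
\<close>

lemma opposite_triangle_free:
  assumes "x \<in> box_sphere d r" "2 \<le> r" "opposite x y" "opposite y z"
  shows "\<not> opposite x z"
proof
  assume "opposite x z"
  obtain i where i: "\<bar>x i\<bar> = int r" using assms by (auto simp: box_sphere_def)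
  have "\<bar>x i + y i\<bar> \<le> 1" "\<bar>y i + z i\<bar> \<le> 1" "\<bar>x i + z i\<bar> \<le> 1"
    using assms \<open>opposite x z\<close> by (simp_all add: opposite_iff)
  then show False using i \<open>2 \<le> r\<close> by linarith
qed

text \<open>
  Averaging over the levels: each vertex has only \<open>d\<close> coordinates and hence lies on at most \<open>d\<close> of the \<open>r\<close>
  levels.
\<close>

lemma exists_sparse_level:
  assumes "finite W" "0 < r"
  shows "\<exists>s<r. r * card {u \<in> W. \<exists>j<d. \<bar>P u j\<bar> = int s} \<le> d * card W"
proof (rule ccontr)
  assume neg: "\<not> ?thesis"
  let ?T = "\<lambda>s. {u \<in> W. \<exists>j<d. \<bar>P u j\<bar> = int s}"
  have less: "d * card W < r * card (?T s)" if "s < r" for s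
    using neg that by (meson not_le)
  have "card (?T s) = (\<Sum>u\<in>W. of_bool (\<exists>j<d. \<bar>P u j\<bar> = int s))" for s
    using assms(1) by (simp add: Int_def)
  then have "(\<Sum>s<r. card (?T s)) = (\<Sum>s<r. \<Sum>u\<in>W. of_bool (\<exists>j<d. \<bar>P u j\<bar> = int s))"
    by (simp only:)
  also have "\<dots> = (\<Sum>u\<in>W. \<Sum>s<r. of_bool (\<exists>j<d. \<bar>P u j\<bar> = int s))" by (rule sum.swap)
  also have "\<dots> \<le> (\<Sum>u\<in>W. d)"
  proof (rule sum_mono)
    fix u
    have "(\<Sum>s<r. of_bool (\<exists>j<d. \<bar>P u j\<bar> = int s)) = card {s \<in> {..<r}. \<exists>j<d. \<bar>P u j\<bar> = int s}"
      by (simp add: Int_def)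
    also have "\<dots> \<le> card ((\<lambda>j. nat \<bar>P u j\<bar>) ` {..<d})"
    proof (rule card_mono)
      show "{s \<in> {..<r}. \<exists>j<d. \<bar>P u j\<bar> = int s} \<subseteq> (\<lambda>j. nat \<bar>P u j\<bar>) ` {..<d}"
      proof
        fix s assume "s \<in> {s \<in> {..<r}. \<exists>j<d. \<bar>P u j\<bar> = int s}"
        then obtain j where "j < d" "\<bar>P u j\<bar> = int s" by blast
        then show "s \<in> (\<lambda>j. nat \<bar>P u j\<bar>) ` {..<d}" by (intro image_eqI[of _ _ j]) simp_all
      qed
    qed simp
    also have "\<dots> \<le> d" using card_image_le[of "{..<d}" "\<lambda>j. nat \<bar>P u j\<bar>"] by simp
    finally show "(\<Sum>s<r. of_bool (\<exists>j<d. \<bar>P u j\<bar> = int s)) \<le> d" .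
  qed
  finally have "(\<Sum>s<r. card (?T s)) \<le> d * card W" by (simp add: mult.commute)
  then have "(\<Sum>s<r. r * card (?T s)) \<le> r * (d * card W)"
    unfolding sum_distrib_left[symmetric] by (rule mult_left_mono) simp
  moreover have "(\<Sum>s<r. d * card W) < (\<Sum>s<r. r * card (?T s))"
    by (rule sum_strict_mono) (use \<open>0 < r\<close> less in auto)
  ultimately show False by simp
qed

text \<open>
  Delete the vertices with a coordinate of absolute value \<open>s\<close>, for a sparse level \<open>s\<close>. For the remaining
  ones, nearly opposite points agree on which coordinates exceed \<open>s\<close> in absolute value, in particular on
  the first such coordinate \<open>i\<close>, and they have opposite signs there.
\<close>

lemma bipartite_remainder:
  fixes P :: "'v \<Rightarrow> nat \<Rightarrow> int"
  assumes W: "finite W" "P ` W \<subseteq> box_sphere d r" and "0 < r"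
  shows "\<exists>T A B. W = T \<union> A \<union> B \<and> A \<inter> B = {} \<and> T \<inter> (A \<union> B) = {} \<and> r * card T \<le> d * card W
     \<and> (\<forall>u\<in>A. \<forall>v\<in>A. \<not> opposite (P u) (P v)) \<and> (\<forall>u\<in>B. \<forall>v\<in>B. \<not> opposite (P u) (P v))"
proof -
  obtain s where s: "s < r" "r * card {u \<in> W. \<exists>j<d. \<bar>P u j\<bar> = int s} \<le> d * card W"
    using exists_sparse_level[OF W(1) \<open>0 < r\<close>, where P = P and d = d] by (elim exE conjE)
  define T where "T = {u \<in> W. \<exists>j<d. \<bar>P u j\<bar> = int s}"
  define i where "i u = (LEAST j. int s < \<bar>P u j\<bar>)" for u
  define A where "A = {u \<in> W - T. 0 < P u (i u)}"
  define B where "B = {u \<in> W - T. P u (i u) < 0}"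
  have i: "int s < \<bar>P u (i u)\<bar>" if "u \<in> W" for u
  proof -
    have "P u \<in> box_sphere d r" by (rule subsetD[OF W(2) imageI[OF that]])
    then obtain j where "\<bar>P u j\<bar> = int r" by (auto simp: box_sphere_def)
    then have "int s < \<bar>P u j\<bar>" using s(1) by simp
    then show ?thesis unfolding i_def by (rule LeastI[of "\<lambda>j. int s < \<bar>P u j\<bar>"])
  qed
  have same: "int s < \<bar>P u j\<bar> \<longleftrightarrow> int s < \<bar>P v j\<bar>"
    if "u \<in> W - T" "v \<in> W - T" "opposite (P u) (P v)" for u v j
  proof (cases "j < d")
    case True
    have "\<bar>P u j + P v j\<bar> \<le> 1" using that(3) by (simp add: opposite_iff)
    moreover have "\<bar>P u j\<bar> \<noteq> int s" "\<bar>P v j\<bar> \<noteq> int s" using that True by (auto simp: T_def)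
    ultimately show ?thesis by linarith
  next
    case False
    have "P u \<in> box_sphere d r" "P v \<in> box_sphere d r" using W(2) that by auto
    with False have "P u j = 0" "P v j = 0" by (simp_all add: box_sphere_def)
    then show ?thesis by simp
  qed
  have opp: "P u (i u) * P v (i v) < 0" if "u \<in> W - T" "v \<in> W - T" "opposite (P u) (P v)" for u v
  proof -
    have "i u = i v" unfolding i_def by (simp add: same[OF that])
    moreover have "\<bar>P u (i u) + P v (i u)\<bar> \<le> 1" using that(3) by (simp add: opposite_iff)
    moreover have "0 < \<bar>P u (i u)\<bar>" "0 < \<bar>P v (i v)\<bar>" using i[of u] i[of v] that by auto
    ultimately show ?thesis by (auto simp: mult_less_0_iff)
  qed
  have nonzero: "P u (i u) \<noteq> 0" if "u \<in> W" for u
    using i[OF that] by linarith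
  have part: "W = T \<union> A \<union> B"
  proof
    show "W \<subseteq> T \<union> A \<union> B"
      using nonzero unfolding A_def B_def by (auto simp: neq_iff)
  qed (auto simp: A_def B_def T_def)
  have A: "\<not> opposite (P u) (P v)" if "u \<in> A" "v \<in> A" for u v
    using opp[of u v] that by (auto simp: A_def mult_less_0_iff)
  have B: "\<not> opposite (P u) (P v)" if "u \<in> B" "v \<in> B" for u v
    using opp[of u v] that by (auto simp: B_def mult_less_0_iff)
  have "A \<inter> B = {}" "T \<inter> (A \<union> B) = {}" by (auto simp: A_def B_def)
  with part A B s(2) show ?thesis
    unfolding T_def[symmetric] by (intro exI[of _ T] exI[of _ A] exI[of _ B]) simp
qed

text \<open>
  Koenig's theorem covers the bipartite remainder, and the \<open>t\<close> deleted vertices are covered by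
  singletons. The set \<open>I\<close> is also chosen at least as large as both sides of the bipartition, so that its
  size is comparable to that of \<open>W\<close>.
\<close>

lemma cover_by_opposite_pairs:
  fixes P :: "'v \<Rightarrow> nat \<Rightarrow> int"
  assumes W: "finite W" "P ` W \<subseteq> box_sphere d r" and "0 < r"
  shows "\<exists>C I t. finite C \<and> \<Union>C = W \<and> (\<forall>K\<in>C. \<forall>u\<in>K. \<forall>v\<in>K. u \<noteq> v \<longrightarrow> opposite (P u) (P v))
     \<and> I \<subseteq> W \<and> (\<forall>u\<in>I. \<forall>v\<in>I. \<not> opposite (P u) (P v))
     \<and> card C \<le> card I + t \<and> card W \<le> 2 * card I + t \<and> r * t \<le> d * card W"
proof -
  obtain T A B where part: "W = T \<union> A \<union> B" "A \<inter> B = {}" "T \<inter> (A \<union> B) = {}"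
    and T: "r * card T \<le> d * card W"
    and indep: "\<And>u v. u \<in> A \<Longrightarrow> v \<in> A \<Longrightarrow> \<not> opposite (P u) (P v)"
      "\<And>u v. u \<in> B \<Longrightarrow> v \<in> B \<Longrightarrow> \<not> opposite (P u) (P v)"
    using bipartite_remainder[OF assms] by metis
  have fin: "finite A" "finite B" "finite T" using W(1) part(1) by auto
  have "\<exists>C I. finite C \<and> \<Union>C = A \<union> B \<and> (\<forall>K\<in>C. \<forall>u\<in>K. \<forall>v\<in>K. u \<noteq> v \<longrightarrow> opposite (P u) (P v))
       \<and> I \<subseteq> A \<union> B \<and> (\<forall>u\<in>I. \<forall>v\<in>I. \<not> opposite (P u) (P v)) \<and> card C \<le> card I"
    by (rule bipartite_edge_cover[OF fin(1,2) part(2) opposite_sym indep])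
  then obtain C I where C: "finite C" "\<Union>C = A \<union> B" "\<forall>K\<in>C. \<forall>u\<in>K. \<forall>v\<in>K. u \<noteq> v \<longrightarrow> opposite (P u) (P v)"
    and I: "I \<subseteq> A \<union> B" "\<forall>u\<in>I. \<forall>v\<in>I. \<not> opposite (P u) (P v)" "card C \<le> card I"
    by (elim exE conjE)
  \<comment> \<open>The largest of the three stable sets \<open>I\<close>, \<open>A\<close>, \<open>B\<close>.\<close>
  define J where "J = (if card A \<le> card I \<and> card B \<le> card I then I else if card A \<le> card B then B else A)"
  have J: "J \<subseteq> W" "\<forall>u\<in>J. \<forall>v\<in>J. \<not> opposite (P u) (P v)"
    using I indep part(1) by (auto simp: J_def)
  have cJ: "card I \<le> card J" "card A \<le> card J" "card B \<le> card J"
    by (auto simp: J_def)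
  let ?C = "C \<union> (\<lambda>u. {u}) ` T"
  have "card ?C \<le> card C + card T"
    by (rule order_trans[OF card_Un_le]) (simp add: card_image_le fin)
  then have "card ?C \<le> card J + card T" using I(3) cJ(1) by linarith
  moreover have "card W = card T + (card A + card B)"
    unfolding part(1) Un_assoc using part fin by (simp add: card_Un_disjoint)
  then have "card W \<le> 2 * card J + card T" using cJ by linarith
  moreover have "finite ?C" "\<Union>?C = W" using C(1,2) fin part(1) by auto
  moreover have "\<forall>K\<in>?C. \<forall>u\<in>K. \<forall>v\<in>K. u \<noteq> v \<longrightarrow> opposite (P u) (P v)" using C(3) by auto
  ultimately show ?thesis using J T by (intro exI[of _ ?C] exI[of _ J] exI[of _ "card T"]) simp
qed

lemma card_box_sphere: "finite (box_sphere d r)" "card (box_sphere d r) \<le> (2 * r + 1) ^ d"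
proof -
  let ?f = "\<lambda>x. restrict x {..<d}"
  have "inj_on ?f (box_sphere d r)"
  proof (rule inj_onI, rule ext)
    fix x y j assume xy: "x \<in> box_sphere d r" "y \<in> box_sphere d r" "?f x = ?f y"
    show "x j = y j"
    proof (cases "j < d")
      case True
      then show ?thesis using fun_cong[OF xy(3), of j] by simp
    next
      case False
      then show ?thesis using xy by (simp add: box_sphere_def)
    qed
  qed
  moreover have sub: "?f ` box_sphere d r \<subseteq> {..<d} \<rightarrow>\<^sub>E {- int r..int r}"
  proof -
    have "- int r \<le> x j \<and> x j \<le> int r" if "x \<in> box_sphere d r" for x j
    proof -
      have "\<bar>x j\<bar> \<le> int r" using that by (simp add: box_sphere_def)
      then show ?thesis by linarith
    qed
    then show ?thesis by (intro image_subsetI restrict_PiE_iff[THEN iffD2]) simp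
  qed
  moreover have fin: "finite ({..<d} \<rightarrow>\<^sub>E {- int r..int r})" by (intro finite_PiE) auto
  moreover have "card ({..<d} \<rightarrow>\<^sub>E {- int r..int r}) = (2 * r + 1) ^ d"
    by (simp add: card_PiE algebra_simps nat_add_distrib nat_mult_distrib)
  ultimately show "finite (box_sphere d r)" "card (box_sphere d r) \<le> (2 * r + 1) ^ d"
    using finite_imageD[OF finite_subset[OF sub fin]] card_inj_on_le[OF _ sub fin] by simp_all
qed

section \<open>The counterexample\<close>

text \<open>
  The box sphere has polynomially many points in \<open>r\<close>, so that powers of logarithms of clique numbers
  are negligible against \<open>r\<close>. For \<open>j < 0\<close> the power is largest at \<open>a = 2\<close>.
\<close>

lemma exists_radius:
  fixes j :: real
  shows "\<exists>r. 2 \<le> r \<and> 2 * d \<le> r \<and>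
    (\<forall>a. 2 \<le> a \<and> a \<le> (2 * r + 1) ^ d \<longrightarrow> 4 * real d * ln (real a) powr j \<le> real r)"
proof -
  define e where "e = \<bar>j\<bar>"
  have "((\<lambda>r. ln (2 * real r + 1) powr e / real r) \<longlonglongrightarrow> 0)"
  proof (cases "e = 0")
    case True
    then have "(\<lambda>r. ln (2 * real r + 1) powr e / real r) = (\<lambda>r. 1 / real r)" by auto
    then show ?thesis by (simp only: lim_1_over_n)
  next
    case False
    then have "0 < e" by (simp add: e_def)
    then show ?thesis by real_asymp
  qed
  then have "((\<lambda>r. 4 * real d * real d powr e * (ln (2 * real r + 1) powr e / real r)) \<longlonglongrightarrow> 4 * real d * real d powr e * 0)"
    by (intro tendsto_intros)
  then have "eventually (\<lambda>r. 4 * real d * real d powr e * (ln (2 * real r + 1) powr e / real r) < 1) sequentially"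
    by (rule order_tendstoD) simp
  moreover have "eventually (\<lambda>r. 4 * real d * ln 2 powr j \<le> real r) sequentially"
    using filterlim_real_sequentially unfolding filterlim_at_top by blast
  moreover have "eventually (\<lambda>r::nat. 2 + 2 * d \<le> r) sequentially" by (rule eventually_ge_at_top)
  ultimately have ev: "eventually (\<lambda>r. 4 * real d * real d powr e * (ln (2 * real r + 1) powr e / real r) < 1 \<and>
      4 * real d * ln 2 powr j \<le> real r \<and> 2 + 2 * d \<le> r) sequentially"
    by (intro eventually_conj)
  obtain r where r1: "4 * real d * real d powr e * (ln (2 * real r + 1) powr e / real r) < 1"
    and r2: "4 * real d * ln 2 powr j \<le> real r" and r3: "2 + 2 * d \<le> r"
    using eventually_happens'[OF sequentially_bot ev] by (elim exE conjE)
  have "4 * real d * ln (real a) powr j \<le> real r" if a: "2 \<le> a" "a \<le> (2 * r + 1) ^ d" for a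
  proof (cases "0 \<le> j")
    case True
    have "real a \<le> real ((2 * r + 1) ^ d)" using a(2) by (simp only: of_nat_le_iff)
    then have "ln (real a) \<le> ln (real ((2 * r + 1) ^ d))" using a(1) by (intro ln_mono) simp_all
    also have "\<dots> = real d * ln (2 * real r + 1)" by (simp add: ln_realpow)
    finally have "ln (real a) powr e \<le> (real d * ln (2 * real r + 1)) powr e"
      using a by (intro powr_mono2) (auto simp: e_def)
    also have "\<dots> = real d powr e * ln (2 * real r + 1) powr e" by (simp add: powr_mult)
    finally have "4 * real d * ln (real a) powr e \<le> 4 * real d * (real d powr e * ln (2 * real r + 1) powr e)"
      by (intro mult_left_mono) auto
    also have "\<dots> \<le> real r" using r1 r3 by (simp add: field_simps)
    finally show ?thesis using True by (simp add: e_def)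
  next
    case False
    have "ln (real a) powr j \<le> ln 2 powr j"
      using a False by (intro powr_mono2') auto
    then show ?thesis using r2 by (meson mult_left_mono of_nat_0_le_iff order_trans mult_nonneg_nonneg zero_le_numeral)
  qed
  then show ?thesis using r3 by (intro exI[of _ r]) auto
qed

lemma induced_subgraphD:
  assumes "induced_subgraph (with_proj H) (with_proj G)"
  shows "pverts H \<subseteq> pverts G" "parcs H = {e \<in> parcs G. fst e \<in> pverts H \<and> snd e \<in> pverts H}"
  using assms by (simp_all add: induced_subgraph_def subgraph_def)

lemma induced_subgraph_refl:
  assumes "pair_graph G"
  shows "induced_subgraph (with_proj G) (with_proj G)"
proof -
  interpret pair_graph G by fact
  have "parcs G = {e \<in> parcs G. fst e \<in> pverts G \<and> snd e \<in> pverts G}"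
    using arc_fst_in_verts arc_snd_in_verts by blast
  then show ?thesis
    by (simp add: induced_subgraph_def subgraph_def compatible_def wf_digraph_wp_iff pair_wf_digraph_axioms)
qed

lemma chromatic_number_le:
  assumes "finite C" "\<And>S. S \<in> C \<Longrightarrow> stable_set G S" "\<Union>C = pverts G"
  shows "chromatic_number G \<le> card C"
  unfolding chromatic_number_def using assms by (intro Least_le exI[of _ C]) simp

lemma finite_clique_cards: "finite (pverts G) \<Longrightarrow> finite {card K |K. clique G K}"
  by (rule finite_subset[of _ "card ` Pow (pverts G)"]) (auto simp: clique_def)

lemma finite_stable_cards: "finite (pverts G) \<Longrightarrow> finite {card S |S. stable_set G S}"
  by (rule finite_subset[of _ "card ` Pow (pverts G)"]) (auto simp: stable_set_def)

lemma clique_number_ge: "finite (pverts G) \<Longrightarrow> clique G K \<Longrightarrow> card K \<le> clique_number G"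
  unfolding clique_number_def by (intro Max_ge finite_clique_cards) auto

lemma clique_number_le: "finite (pverts G) \<Longrightarrow> clique_number G \<le> card (pverts G)"
  unfolding clique_number_def
  by (rule Max.boundedI) (auto simp: finite_clique_cards clique_def card_mono intro: exI[of _ "{}"])

lemma stability_number_le:
  assumes "finite (pverts G)" "\<And>S. stable_set G S \<Longrightarrow> card S \<le> n"
  shows "stability_number G \<le> n"
  unfolding stability_number_def
  by (rule Max.boundedI) (use assms finite_stable_cards in \<open>auto simp: stable_set_def intro: exI[of _ "{}"]\<close>)

lemma clique_cover_exists:
  assumes "finite (pverts G)"
  obtains C where "finite C" "card C = clique_cover_number G" "\<And>K. K \<in> C \<Longrightarrow> clique G K" "\<Union>C = pverts G"
proof -
  have "\<exists>n C. finite C \<and> card C = n \<and> (\<forall>K\<in>C. clique G K) \<and> \<Union>C = pverts G"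
    by (rule exI, rule exI[of _ "(\<lambda>v. {v}) ` pverts G"]) (use assms in \<open>auto simp: clique_def\<close>)
  then have "\<exists>C. finite C \<and> card C = clique_cover_number G \<and> (\<forall>K\<in>C. clique G K) \<and> \<Union>C = pverts G"
    unfolding clique_cover_number_def by (rule LeastI_ex)
  then show ?thesis using that by (elim exE conjE) simp
qed

definition anti_borsuk_graph :: "(nat \<Rightarrow> nat \<Rightarrow> int) \<Rightarrow> nat \<Rightarrow> nat pair_pre_digraph" where
  "anti_borsuk_graph P n = \<lparr>pverts = {..<n},
     parcs = {(u, v). u < n \<and> v < n \<and> u \<noteq> v \<and> \<not> opposite (P u) (P v)}\<rparr>"

lemma pair_graph_anti_borsuk: "pair_graph (anti_borsuk_graph P n)"
proof
  show "finite (parcs (anti_borsuk_graph P n))"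
    by (rule finite_subset[of _ "{..<n} \<times> {..<n}"]) (auto simp: anti_borsuk_graph_def)
  show "symmetric (with_proj (anti_borsuk_graph P n))"
    using opposite_sym by (auto simp: anti_borsuk_graph_def symmetric_def sym_def arcs_ends_def arc_to_ends_def image_iff)
qed (auto simp: anti_borsuk_graph_def)

lemma induced_anti_borsuk:
  assumes "induced_subgraph (with_proj H) (with_proj (anti_borsuk_graph P n))"
  shows "pverts H \<subseteq> {..<n}"
    and "(u, v) \<in> parcs H \<longleftrightarrow> u \<in> pverts H \<and> v \<in> pverts H \<and> u \<noteq> v \<and> \<not> opposite (P u) (P v)"
proof -
  show sub: "pverts H \<subseteq> {..<n}"
    using induced_subgraphD(1)[OF assms] by (simp add: anti_borsuk_graph_def)
  show "(u, v) \<in> parcs H \<longleftrightarrow> u \<in> pverts H \<and> v \<in> pverts H \<and> u \<noteq> v \<and> \<not> opposite (P u) (P v)"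
    using induced_subgraphD(2)[OF assms] sub by (auto simp: anti_borsuk_graph_def)
qed

text \<open>
  Stable sets consist of pairwise nearly opposite points, and three of these cannot exist.
\<close>

lemma stability_number_anti_borsuk:
  assumes P: "P ` {..<n} \<subseteq> box_sphere d r" and r: "2 \<le> r"
  shows "stability_number (anti_borsuk_graph P n) \<le> 2"
proof (rule stability_number_le)
  fix S assume S: "stable_set (anti_borsuk_graph P n) S"
  have opp: "opposite (P u) (P v)" if "u \<in> S" "v \<in> S" "u \<noteq> v" for u v
    using S that unfolding stable_set_def by (auto simp: anti_borsuk_graph_def)
  show "card S \<le> 2"
  proof (rule ccontr)
    assume "\<not> card S \<le> 2"
    then have "3 \<le> card S" by simp
    then obtain U where U: "U \<subseteq> S" "card U = 3" by (rule obtain_subset_with_card_n)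
    then obtain x y z where U3: "U = {x, y, z}" "x \<noteq> y" "y \<noteq> z" "x \<noteq> z"
      by (auto simp: card_3_iff)
    then have xyz: "x \<in> S" "y \<in> S" "z \<in> S" using U(1) by auto
    then have "P x \<in> box_sphere d r" using S P by (auto simp: stable_set_def anti_borsuk_graph_def)
    then show False
      using opposite_triangle_free[OF _ r opp[OF xyz(1,2)] opp[OF xyz(2,3)]] opp[OF xyz(1,3)] U3(2-4) by simp
  qed
qed (simp add: anti_borsuk_graph_def)

text \<open>
  A cover by cliques colours the box sphere so that nearly opposite points receive different colours.
\<close>

lemma clique_cover_number_anti_borsuk:
  assumes P: "P ` {..<n} = box_sphere d r" and "0 < d" "0 < r"
  shows "d < clique_cover_number (anti_borsuk_graph P n)"
proof -
  let ?G = "anti_borsuk_graph P n"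
  obtain C where C: "finite C" "card C = clique_cover_number ?G" "\<And>K. K \<in> C \<Longrightarrow> clique ?G K" "\<Union>C = pverts ?G"
    by (rule clique_cover_exists[of ?G]) (simp_all add: anti_borsuk_graph_def)
  obtain h where h: "bij_betw h C {0..<card C}"
    using ex_bij_betw_finite_nat[OF C(1)] by blast
  define idx where "idx x = (SOME u. u < n \<and> P u = x)" for x
  define K where "K x = (SOME K. K \<in> C \<and> idx x \<in> K)" for x
  have idx: "idx x < n \<and> P (idx x) = x" if "x \<in> box_sphere d r" for x
  proof -
    have "x \<in> P ` {..<n}" using that P by simp
    then have "\<exists>u. u < n \<and> P u = x" by auto
    then show ?thesis unfolding idx_def by (rule someI_ex)
  qed
  have K: "K x \<in> C \<and> idx x \<in> K x" if "x \<in> box_sphere d r" for x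
  proof -
    have "idx x \<in> \<Union>C" unfolding C(4) using idx[OF that] by (simp add: anti_borsuk_graph_def)
    then have "\<exists>K. K \<in> C \<and> idx x \<in> K" by blast
    then show ?thesis unfolding K_def by (rule someI_ex)
  qed
  have "d < card C"
  proof (rule box_sphere_colouring_bound[OF \<open>0 < d\<close>])
    fix x assume "x \<in> box_sphere d r"
    then show "h (K x) < card C" using K bij_betwE[OF h] by auto
  next
    fix x y assume x: "x \<in> box_sphere d r" and y: "y \<in> box_sphere d r" and "near x (antipode y)"
    then have opp: "opposite x y" by (simp add: opposite_def)
    show "h (K x) \<noteq> h (K y)"
    proof
      assume "h (K x) = h (K y)"
      then have same: "K x = K y"
        using inj_onD[OF bij_betw_imp_inj_on[OF h]] K[OF x] K[OF y] by simp
      have "idx x \<in> K x" "idx y \<in> K x" using K[OF x] K[OF y] same by simp_all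
      moreover have "clique ?G (K x)" using C(3) K[OF x] by simp
      moreover have "idx x \<noteq> idx y"
        using idx[OF x] idx[OF y] opp opposite_irrefl[OF x \<open>0 < r\<close>] by metis
      ultimately have "(idx x, idx y) \<in> parcs ?G" unfolding clique_def by blast
      then show False using opp idx[OF x] idx[OF y] by (simp add: anti_borsuk_graph_def)
    qed
  qed
  then show ?thesis using C(2) by simp
qed

text \<open>
  With \<open>a\<close> the clique number of an induced subgraph, the excess \<open>t\<close> over \<open>a\<close> in the cover above is at most
  \<open>4 * d * a / r\<close>: for \<open>d > 0\<close> the bound \<open>2 * d \<le> r\<close> limits the number of vertices to \<open>4 * a\<close>, and for
  \<open>d = 0\<close> there is no excess. If \<open>a = 1\<close>, the subgraph has no edges and one colour suffices.
\<close>

lemma chi_bounded_anti_borsuk: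
  fixes j c :: real
  assumes P: "P ` {..<n} \<subseteq> box_sphere d r" and "1 \<le> c" and r: "0 < r" "2 * d \<le> r"
    and log: "\<And>a. 2 \<le> a \<Longrightarrow> a \<le> n \<Longrightarrow> 4 * real d * ln (real a) powr j \<le> real r"
  shows "chi_bounded_by (\<lambda>x. if x = 1 then c else real x + real x / ln (real x) powr j) (anti_borsuk_graph P n)"
  unfolding chi_bounded_by_def
proof (intro allI impI, elim conjE)
  fix H :: "nat pair_pre_digraph"
  assume H: "induced_subgraph (with_proj H) (with_proj (anti_borsuk_graph P n))" and ne: "pverts H \<noteq> {}"
  note arcs = induced_anti_borsuk(2)[OF H]
  have sub: "pverts H \<subseteq> {..<n}" by (rule induced_anti_borsuk(1)[OF H])
  have fin: "finite (pverts H)" by (rule finite_subset[OF sub]) simp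
  have PH: "P ` pverts H \<subseteq> box_sphere d r" using P sub by blast
  let ?a = "clique_number H"
  obtain u where u: "u \<in> pverts H" using ne by blast
  then have "clique H {u}" by (simp add: clique_def)
  then have a1: "1 \<le> ?a" using clique_number_ge[OF fin] by force
  have an: "?a \<le> n"
    using clique_number_le[OF fin] card_mono[OF _ sub] by simp
  show "real (chromatic_number H) \<le> (if ?a = 1 then c else real ?a + real ?a / ln (real ?a) powr j)"
  proof (cases "?a = 1")
    case True
    have "stable_set H (pverts H)"
      unfolding stable_set_def
    proof (intro conjI subset_refl ballI notI)
      fix v w assume vw: "v \<in> pverts H" "w \<in> pverts H" and arc: "(v, w) \<in> parcs H"
      then have "clique H {v, w}" "v \<noteq> w"
        using opposite_sym[of "P w" "P v"] by (auto simp: clique_def arcs)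
      then show False using clique_number_ge[OF fin, of "{v, w}"] True by simp
    qed
    then have "chromatic_number H \<le> card {pverts H}" by (intro chromatic_number_le) auto
    then show ?thesis using True \<open>1 \<le> c\<close> by simp
  next
    case False
    then have a2: "2 \<le> ?a" using a1 by simp
    obtain C I t where C: "finite C" "\<Union>C = pverts H"
        "\<forall>K\<in>C. \<forall>u\<in>K. \<forall>v\<in>K. u \<noteq> v \<longrightarrow> opposite (P u) (P v)"
      and I: "I \<subseteq> pverts H" "\<forall>u\<in>I. \<forall>v\<in>I. \<not> opposite (P u) (P v)"
      and CI: "card C \<le> card I + t" and WI: "card (pverts H) \<le> 2 * card I + t"
      and t: "r * t \<le> d * card (pverts H)"
      using cover_by_opposite_pairs[OF fin PH \<open>0 < r\<close>] by (elim exE conjE)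
    have "stable_set H K" if "K \<in> C" for K
      using C(2,3) that by (auto simp: stable_set_def arcs)
    then have chi: "chromatic_number H \<le> card C" using C(1,2) by (intro chromatic_number_le)
    have "clique H I" using I by (auto simp: clique_def arcs)
    then have Ia: "card I \<le> ?a" by (rule clique_number_ge[OF fin])
    have "2 * d * t \<le> r * t" using r(2) by (rule mult_right_mono) simp
    also note t
    finally have dt: "d * (2 * t) \<le> d * card (pverts H)" by (simp add: ac_simps)
    have t_le: "r * t \<le> 4 * d * ?a"
    proof (cases "d = 0")
      case True
      then show ?thesis using t by simp
    next
      case False
      then have "2 * t \<le> card (pverts H)" using dt by simp
      then have "card (pverts H) \<le> 4 * ?a" using WI Ia by linarith
      then have "d * card (pverts H) \<le> d * (4 * ?a)" by (rule mult_left_mono) simp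
      with t have "r * t \<le> d * (4 * ?a)" by (rule order_trans)
      then show ?thesis by (simp add: ac_simps)
    qed
    define L where "L = ln (real ?a) powr j"
    have L: "0 < L" using a2 by (simp add: L_def)
    have "real (r * t) \<le> real (4 * d * ?a)" using t_le by (simp only: of_nat_le_iff)
    then have "real r * real t * L \<le> 4 * real d * real ?a * L"
      using L by (intro mult_right_mono) simp_all
    also have "\<dots> = (4 * real d * L) * real ?a" by simp
    also have "\<dots> \<le> real r * real ?a"
      using log[OF a2 an] by (intro mult_right_mono) (simp_all add: L_def)
    finally have "real r * (real t * L) \<le> real r * real ?a" by (simp add: ac_simps)
    then have "real t * L \<le> real ?a" using r(1) by simp
    then have "real t \<le> real ?a / L" using L by (simp add: field_simps)
    moreover have "real (chromatic_number H) \<le> real ?a + real t" using chi CI Ia by linarith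
    ultimately show ?thesis using False by (simp add: L_def)
  qed
qed

text \<open>
  A putative \<open>g\<close> is only evaluated at stability numbers at most two. Taking \<open>d\<close> at least as large as
  these values, the clique cover number exceeds all of them.
\<close>

theorem theorem4p8:
  fixes j c :: real
  assumes "c \<ge> 1"
  shows "\<not> complementary_bounded
           (\<lambda>x::nat. if x = 1 then c else real x + real x / ln (real x) powr j)"
proof
  let ?f = "\<lambda>x::nat. if x = 1 then c else real x + real x / ln (real x) powr j"
  assume "complementary_bounded ?f"
  then obtain g :: "nat \<Rightarrow> real" where
    g: "\<And>G :: nat pair_pre_digraph. pair_graph G \<Longrightarrow> chi_bounded_by ?f G \<Longrightarrow> theta_bounded_by g G"
    unfolding complementary_bounded_def by blast
  define d where "d = Suc (nat \<lceil>max (g 0) (max (g 1) (g 2))\<rceil>)"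
  have d: "g 0 \<le> real d" "g 1 \<le> real d" "g 2 \<le> real d" "0 < d"
    unfolding d_def by linarith+
  obtain r where r: "2 \<le> r" "2 * d \<le> r"
    and log: "\<forall>a. 2 \<le> a \<and> a \<le> (2 * r + 1) ^ d \<longrightarrow> 4 * real d * ln (real a) powr j \<le> real r"
    using exists_radius[of d j] by (elim exE conjE)
  define n where "n = card (box_sphere d r)"
  obtain P where "bij_betw P {0..<n} (box_sphere d r)"
    using ex_bij_betw_nat_finite[OF card_box_sphere(1)] unfolding n_def by blast
  then have P: "P ` {..<n} = box_sphere d r" by (simp add: bij_betw_def atLeast0LessThan)
  let ?G = "anti_borsuk_graph P n"
  have "chi_bounded_by ?f ?G"
  proof (rule chi_bounded_anti_borsuk)
    show "4 * real d * ln (real a) powr j \<le> real r" if "2 \<le> a" "a \<le> n" for a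
      using log that card_box_sphere(2)[of d r] by (simp add: n_def)
  qed (use P r assms in auto)
  then have "theta_bounded_by g ?G" using g pair_graph_anti_borsuk by blast
  moreover have cover: "d < clique_cover_number ?G"
    using clique_cover_number_anti_borsuk[OF P] d(4) r(1) by simp
  moreover have "pverts ?G \<noteq> {}"
  proof
    assume "pverts ?G = {}"
    then have "box_sphere d r = {}" using P by (simp add: anti_borsuk_graph_def)
    moreover have "pole 0 r \<in> box_sphere d r" using d(4) by (auto simp: box_sphere_def pole_def)
    ultimately show False by blast
  qed
  ultimately have "real (clique_cover_number ?G) \<le> g (stability_number ?G)"
    using induced_subgraph_refl[OF pair_graph_anti_borsuk] unfolding theta_bounded_by_def by blast
  moreover have "stability_number ?G \<le> 2"
    by (rule stability_number_anti_borsuk) (use P r in auto)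
  then have "stability_number ?G = 0 \<or> stability_number ?G = 1 \<or> stability_number ?G = 2" by linarith
  then have "g (stability_number ?G) \<le> real d" using d by auto
  ultimately show False using cover by linarith
qed

end
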